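(* Let $q$ be a complex number with $0<|q|<1$, and set $$A_5:=\frac{\varphi(-q)\varphi(-q^5)}{q^{6}\psi(q^8)\psi(q^{40})},\qquad B_5:=\frac{\varphi(-q)\psi(q^{40})}{q^{-4}\varphi(-q^5)\psi(q^8)}.$$ Then $$\begin{aligned} B^3_5+\frac{1}{B^3_5}-1620={}&70\left(B^2_5+\frac{1}{B^2_5}\right)+785\left(B_5+\frac{1}{B_5}\right)+\left(A_5^2+\frac{8^4}{A_5^2}\right)\\ &+80\left(\sqrt{A_5}+\frac{8}{\sqrt{A_5}}\right)\left[5\left(\sqrt{B_5}+\frac{1}{\sqrt{B_5}}\right)+\left(\sqrt{B^3_5}+\frac{1}{\sqrt{B^3_5}}\right)\right]\\ &+20\left(A_5+\frac{8^2}{A_5}\right)\left[5+2\left(B_5+\frac{1}{B_5}\right)\right]\\ &+10\left(\sqrt{A_5^3}+\frac{8^3}{\sqrt{A_5^3}}\right)\left(\sqrt{B_5}+\frac{1}{\sqrt{B_5}}\right).\end{aligned}$$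
   Context: For $|q|<1$, $\varphi(q)=\sum_{m=-\infty}^{\infty}q^{m^2}$ and $\psi(q)=\sum_{m=0}^{\infty}q^{m(m+1)/2}$. The square roots $\sqrt{A_5},\sqrt{B_5}$ are chosen so that $\sqrt{A_5}\sqrt{B_5}=\dfrac{\varphi(-q)}{q\psi(q^8)}$, and $\sqrt{A_5^3}=(\sqrt{A_5})^3$, $\sqrt{B_5^3}=(\sqrt{B_5})^3$; for $0<q<1$, $A_5$ and $B_5$ are positive and these are the positive square roots. *)

theory Defs
  imports "HOL-Analysis.Analysis"
begin

text \<open>
  Ramanujan's theta functions; both series converge absolutely for \<open>norm q < 1\<close>,
  and only such arguments are of interest.
\<close>

definition ramanujan_phi :: "complex \<Rightarrow> complex" where
  "ramanujan_phi q = (\<Sum>\<^sub>\<infinity>m\<in>(UNIV :: int set). q powi (m ^ 2))"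

definition ramanujan_psi :: "complex \<Rightarrow> complex" where
  "ramanujan_psi q = (\<Sum>m. q ^ (m * (m + 1) div 2))"

definition A5 :: "complex \<Rightarrow> complex" where
  "A5 q = ramanujan_phi (- q) * ramanujan_phi (- (q ^ 5)) /
          (q ^ 6 * ramanujan_psi (q ^ 8) * ramanujan_psi (q ^ 40))"

definition B5 :: "complex \<Rightarrow> complex" where
  "B5 q = ramanujan_phi (- q) * ramanujan_psi (q ^ 40) /
          (q powi (- 4) * ramanujan_phi (- (q ^ 5)) * ramanujan_psi (q ^ 8))"

text \<open>
  \<open>a\<close> and \<open>b\<close> are admissible choices of the square roots of \<open>A5 q\<close> and \<open>B5 q\<close>.
  The product condition determines the pair up to a simultaneous change of sign; for
  \<open>0 < q < 1\<close> the two positive square roots form one of the two admissible pairs.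
\<close>

definition admissible_roots :: "complex \<Rightarrow> complex \<Rightarrow> complex \<Rightarrow> bool" where
  "admissible_roots q a b \<longleftrightarrow>
     a ^ 2 = A5 q \<and> b ^ 2 = B5 q \<and>
     a * b = ramanujan_phi (- q) / (q * ramanujan_psi (q ^ 8))"

end

theory Submission
  imports Defs "HOL-Complex_Analysis.Complex_Analysis"
begin

text \<open>
  With \<open>u = \<phi>(-q) / (q \<psi>(q\<^sup>8))\<close> and \<open>v\<close> the same quotient at \<open>q\<^sup>5\<close> we have \<open>A\<^sub>5 = u v\<close> and
  \<open>B\<^sub>5 = u / v\<close>, and since \<open>\<phi>(q) - \<phi>(-q) = 4 q \<psi>(q\<^sup>8)\<close> the claim is a polynomial relation between
  \<open>x = \<phi>(-q) / \<phi>(q)\<close> and \<open>y = \<phi>(-q\<^sup>5) / \<phi>(q\<^sup>5)\<close>, the classical modular equation of degree 5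
  \<open>P(x, y) = (x - y)\<^sup>2 (x\<^sup>2 + 6 x y + y\<^sup>2)\<^sup>2 - 16 x y (1 - x\<^sup>2 y\<^sup>2)\<^sup>2 = 0\<close>.
  By Landen's transformation, \<open>X = x(q\<^sup>2)\<close> satisfies \<open>X\<^sup>2 = 2 x / (1 + x\<^sup>2)\<close>, and likewise for
  \<open>Y = y(q\<^sup>2)\<close>. This makes \<open>P(X, Y) P(-X, Y)\<close> a multiple of \<open>P(x, y) P(x, 1 / y)\<close>, where the second
  factor on the left does not vanish at \<open>q = 0\<close> and the second one on the right has a zero of order 6.
  Comparing leading terms at \<open>q = 0\<close> shows that \<open>P(x, y)\<close> cannot have a zero of finite order there.
\<close>

subsection \<open>Products of sums and lacunary series\<close>

text \<open>Absolute summability of both families makes the double family absolutely summable. Its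
  sum can then be evaluated iteratively, and uniqueness identifies it with
  \<open>a * b\<close>.\<close>

lemma has_sum_product:
  fixes f :: "'a \<Rightarrow> 'c::{real_normed_field,banach}" and g :: "'b \<Rightarrow> 'c"
  assumes "(\<lambda>x. norm (f x)) summable_on A" "(\<lambda>y. norm (g y)) summable_on B"
    "(f has_sum a) A" "(g has_sum b) B"
  shows "((\<lambda>(x,y). f x * g y) has_sum (a * b)) (A \<times> B)"
proof -
  have "(\<lambda>z. norm ((\<lambda>(x,y). f x * g y) z)) summable_on (A \<times> B)"
    unfolding Infinite_Sum.abs_summable_on_Sigma_iff
    using assms by (auto simp: norm_mult abs_mult infsum_cmult_right'
        intro!: summable_on_cmult_right summable_on_cmult_left)
  then obtain s where s: "((\<lambda>(x,y). f x * g y) has_sum s) (A \<times> B)"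
    using abs_summable_summable unfolding summable_on_def by blast
  have "((\<lambda>x. f x * b) has_sum s) A"
    by (rule has_sum_SigmaD[OF s]) (use has_sum_cmult_right[OF assms(4)] in auto)
  moreover have "((\<lambda>x. f x * b) has_sum (a * b)) A"
    by (rule has_sum_cmult_left[OF assms(3)])
  ultimately have "s = a * b" by (rule has_sum_unique)
  with s show ?thesis by simp
qed

lemma summable_norm_lacunary:
  fixes q :: complex
  assumes "norm q < 1" "\<And>n. n \<le> e n"
  shows "summable (\<lambda>n. norm (q ^ e n))"
proof (rule summable_comparison_test')
  show "summable (\<lambda>n. norm q ^ n)" using assms by (simp add: summable_geometric)
  show "norm (norm (q ^ e n)) \<le> norm q ^ n" for n
    using assms by (simp add: norm_power power_decreasing)
qed

text \<open>On a closed disc inside the unit ball the norm is bounded by some \<open>r < 1\<close>,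
  and \<open>n \<le> e n\<close> majorises the terms by the geometric series. The Weierstrass test
  then gives locally uniform convergence of the polynomial partial sums.\<close>

lemma holomorphic_lacunary:
  assumes "\<And>n. n \<le> e n"
  shows "(\<lambda>q. \<Sum>n. q ^ e n) holomorphic_on ball (0::complex) 1"
proof (rule holomorphic_uniform_sequence)
  fix x :: complex assume "x \<in> ball 0 1"
  then obtain d where d: "d > 0" "cball x d \<subseteq> ball 0 1"
    by (meson open_ball open_contains_cball)
  obtain r where r: "r < 1" "\<And>y. y \<in> cball x d \<Longrightarrow> norm y \<le> r"
  proof -
    obtain y where y: "y \<in> cball x d" "\<And>z. z \<in> cball x d \<Longrightarrow> norm z \<le> norm y"
      using continuous_attains_sup[OF compact_cball _ continuous_on_norm_id, of x d] d by auto
    show ?thesis using that[of "norm y"] y d by auto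
  qed
  then have "0 \<le> r" using d by (metis centre_in_cball less_imp_le norm_ge_zero order_trans)
  have "uniform_limit (cball x d) (\<lambda>n q. \<Sum>i<n. q ^ e i) (\<lambda>q. \<Sum>n. q ^ e n) sequentially"
  proof (rule Weierstrass_m_test)
    show "summable (\<lambda>n. r ^ n)" using r \<open>0 \<le> r\<close> by (simp add: summable_geometric)
    fix n y assume "y \<in> cball x d"
    then have "norm y \<le> r" using r by auto
    then have "norm (y ^ e n) \<le> r ^ e n" by (simp add: norm_power power_mono)
    also have "\<dots> \<le> r ^ n" using assms r \<open>0 \<le> r\<close> by (simp add: power_decreasing)
    finally show "norm (y ^ e n) \<le> r ^ n" .
  qed
  with d show "\<exists>d>0. cball x d \<subseteq> ball 0 1 \<and>
      uniform_limit (cball x d) (\<lambda>n q. \<Sum>i<n. q ^ e i) (\<lambda>q. \<Sum>n. q ^ e n) sequentially"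
    by blast
qed (auto intro!: holomorphic_intros)

lemma has_sum_lacunary:
  fixes q :: complex
  assumes "norm q < 1" "\<And>n. n \<le> e n"
  shows "((\<lambda>n. q ^ e n) has_sum (\<Sum>n. q ^ e n)) UNIV"
  using norm_summable_imp_has_sum[OF summable_norm_lacunary[OF assms]]
    summable_sums[OF summable_norm_cancel[OF summable_norm_lacunary[OF assms]]] by simp

lemma le_triangular: "n \<le> n * (n + 1) div (2::nat)"
proof -
  have "2 * n \<le> n * (n + 1)" by (cases n) auto
  then show ?thesis by linarith
qed

subsection \<open>Dissections and Landen transformation of theta functions\<close>

lemma abs_summable_square_powers:
  fixes q :: complex
  assumes "norm q < 1"
  shows "(\<lambda>m::int. norm (q ^ nat (m^2))) summable_on A"
proof -
  have s: "summable (\<lambda>n. norm (q ^ nat ((int n)^2)))"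
  proof (rule summable_norm_lacunary[OF assms])
    show "n \<le> nat ((int n)^2)" for n
      by (cases n) (simp_all add: power2_eq_square nat_mult_distrib flip: of_nat_mult of_nat_Suc)
  qed
  then have "(\<lambda>n. norm (q ^ nat ((int n)^2))) summable_on UNIV"
    by (simp add: summable_on_UNIV_nonneg_real_iff)
  then have "(\<lambda>m. norm (q ^ nat (m^2))) summable_on range int"
    "(\<lambda>m. norm (q ^ nat (m^2))) summable_on range (\<lambda>n. - int n)"
    by (simp_all add: summable_on_reindex inj_on_def o_def)
  \<comment> \<open>The two ranges overlap at 0, which is harmless because only summability is
    claimed.\<close>
  then have s2: "(\<lambda>m. norm (q ^ nat (m^2))) summable_on (range int \<union> range (\<lambda>n. - int n))"
    by (rule summable_on_union)
  have "m \<in> range int \<union> range (\<lambda>n. - int n)" for m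
    by (cases m rule: int_cases2) auto
  then show ?thesis
    by (intro summable_on_subset_banach[OF s2]) blast
qed

lemma has_sum_phi:
  assumes "norm q < 1"
  shows "((\<lambda>m::int. q ^ nat (m^2)) has_sum ramanujan_phi q) UNIV"
proof -
  have "ramanujan_phi q = (\<Sum>\<^sub>\<infinity>m::int. q ^ nat (m^2))"
    unfolding ramanujan_phi_def by (simp add: power_int_def)
  then show ?thesis
    using abs_summable_summable[OF abs_summable_square_powers[OF assms]] by auto
qed

lemma has_sum_even_squares:
  assumes "norm q < 1"
  shows "((\<lambda>m::int. q ^ nat (m^2)) has_sum ramanujan_phi (q^4)) {m. even m}"
proof -
  have "norm (q^4) < 1" using assms by (simp add: norm_power power_less_one_iff)
  from has_sum_phi[OF this] have "((\<lambda>m. q ^ nat (m^2)) \<circ> (\<lambda>m. 2*m) has_sum ramanujan_phi (q^4)) UNIV"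
    by (simp add: o_def power_mult_distrib nat_mult_distrib power_mult)
  moreover have "range (\<lambda>m::int. 2*m) = {m. even m}" by (auto elim: evenE)
  ultimately show ?thesis by (metis has_sum_reindex inj_on_def mult_cancel_left zero_neq_numeral)
qed

text \<open>Since (2n+1)^2 = 8 n(n+1)/2 + 1, the positive odd integers contribute
  \<open>q * ramanujan_psi (q^8)\<close>, and the negative ones contribute the same.\<close>

lemma has_sum_odd_squares:
  assumes "norm q < 1"
  shows "((\<lambda>m::int. q ^ nat (m^2)) has_sum (2 * q * ramanujan_psi (q^8))) {m. odd m}"
proof -
  have "norm (q^8) < 1" using assms by (simp add: norm_power power_less_one_iff)
  from has_sum_cmult_right[OF has_sum_lacunary[OF this le_triangular], of q]
  have 1: "((\<lambda>n. q * (q^8) ^ (n*(n+1) div 2)) has_sum (q * ramanujan_psi (q^8))) UNIV"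
    unfolding ramanujan_psi_def .
  have 2: "q ^ nat ((2 * int n + 1)^2) = q * (q^8) ^ (n*(n+1) div 2)" for n
  proof -
    obtain k where k: "n*(n+1) = 2*k" by (metis even_mult_iff evenE odd_add odd_one)
    have "nat ((2 * int n + 1)^2) = (2*n+1)^2"
      by (metis nat_int of_nat_1 of_nat_Suc of_nat_add of_nat_mult of_nat_numeral of_nat_power)
    also have "\<dots> = 8*k+1" using k by (simp add: power2_eq_square algebra_simps)
    finally show ?thesis using k by (simp add: power_mult)
  qed
  have "((\<lambda>m. q ^ nat (m^2)) has_sum (q * ramanujan_psi (q^8))) (range (\<lambda>n. 2 * int n + 1))"
    using 1 by (subst has_sum_reindex) (auto simp: inj_on_def o_def 2)
  moreover have "((\<lambda>m. q ^ nat (m^2)) has_sum (q * ramanujan_psi (q^8))) (range (\<lambda>n. - (2 * int n + 1)))"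
    using 1 by (subst has_sum_reindex) (auto simp: inj_on_def o_def 2 simp del: minus_add_distrib)
  moreover have "range (\<lambda>n. 2 * int n + 1) \<inter> range (\<lambda>n. - (2 * int n + 1)) = {}" by auto
  ultimately have "((\<lambda>m. q ^ nat (m^2)) has_sum (q * ramanujan_psi (q^8) + q * ramanujan_psi (q^8)))
     (range (\<lambda>n. 2 * int n + 1) \<union> range (\<lambda>n. - (2 * int n + 1)))"
    by (rule has_sum_Un_disjoint)
  moreover have "range (\<lambda>n. 2 * int n + 1) \<union> range (\<lambda>n. - (2 * int n + 1)) = {m. odd m}"
  proof (intro equalityI subsetI)
    fix m :: int assume "m \<in> {m. odd m}"
    then obtain k where k: "m = 2*k+1" by (auto elim: oddE)
    show "m \<in> range (\<lambda>n. 2 * int n + 1) \<union> range (\<lambda>n. - (2 * int n + 1))"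
    proof (cases "k \<ge> 0")
      case True then show ?thesis using k by (intro UnI1 range_eqI[of _ _ "nat k"]) auto
    next
      case False then show ?thesis using k by (intro UnI2 range_eqI[of _ _ "nat (-k-1)"]) auto
    qed
  qed auto
  ultimately show ?thesis by (simp only: mult.assoc mult_2 distrib_right)
qed

lemma phi_dissect:
  assumes "norm q < 1"
  shows "ramanujan_phi q = ramanujan_phi (q^4) + 2 * q * ramanujan_psi (q^8)"
proof -
  have "{m::int. even m} \<union> {m. odd m} = UNIV" "{m::int. even m} \<inter> {m. odd m} = {}" by auto
  then show ?thesis
    using has_sum_Un_disjoint[OF has_sum_even_squares[OF assms] has_sum_odd_squares[OF assms]]
      has_sum_unique[OF has_sum_phi[OF assms]] by simp
qed

lemma phi_minus_dissect:
  assumes "norm q < 1"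
  shows "ramanujan_phi (- q) = ramanujan_phi (q^4) - 2 * q * ramanujan_psi (q^8)"
  using phi_dissect[of "-q"] assms by simp

text \<open>The substitution \<open>m = a + b\<close>, \<open>n = a - b\<close> identifies pairs of integers of equal parity with
  arbitrary pairs \<open>(a, b)\<close>.\<close>

lemma phi_square:
  assumes q: "norm q < 1" and s: "s = 1 \<or> s = -1"
  shows "ramanujan_phi (s * q^2) ^ 2 = ramanujan_phi (q^4) ^ 2 + s * (2 * q * ramanujan_psi (q^8)) ^ 2"
proof -
  define f where "f m = q ^ nat (m^2)" for m :: int
  \<comment> \<open>For m = a + b and n = a - b the weight equals \<open>s ^ (a^2 + b^2)\<close>,
    because a^2 + b^2 has the parity of m.\<close>
  define F where "F = (\<lambda>(m, n). (if even m then 1 else s) * (f m * f n))"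
  have abs: "(\<lambda>m. norm (f m)) summable_on A" for A
    unfolding f_def by (rule abs_summable_square_powers[OF q])
  define E D where "E = {m::int. even m}" and "D = {m::int. odd m}"
  have "((\<lambda>(m,n). f m * f n) has_sum (ramanujan_phi (q^4) * ramanujan_phi (q^4))) (E \<times> E)"
    unfolding E_def using has_sum_even_squares[OF q] by (intro has_sum_product abs) (simp_all add: f_def)
  then have 1: "(F has_sum (ramanujan_phi (q^4) ^ 2)) (E \<times> E)"
    unfolding power2_eq_square by (rule has_sum_cong[THEN iffD1, rotated]) (auto simp: F_def E_def)
  have "((\<lambda>(m,n). f m * f n) has_sum ((2 * q * ramanujan_psi (q^8)) * (2 * q * ramanujan_psi (q^8))))
      (D \<times> D)"
    unfolding D_def using has_sum_odd_squares[OF q] by (intro has_sum_product abs) (simp_all add: f_def)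
  from has_sum_cmult_right[OF this, of s]
  have 2: "(F has_sum (s * (2 * q * ramanujan_psi (q^8)) ^ 2)) (D \<times> D)"
    unfolding power2_eq_square by (rule has_sum_cong[THEN iffD1, rotated]) (auto simp: F_def D_def)
  have 3: "(F has_sum (ramanujan_phi (q^4) ^ 2 + s * (2 * q * ramanujan_psi (q^8)) ^ 2)) (E \<times> E \<union> D \<times> D)"
    by (rule has_sum_Un_disjoint[OF 1 2]) (auto simp: E_def D_def)
  have bij: "bij_betw (\<lambda>(a,b). (a+b, a-b)) UNIV (E \<times> E \<union> D \<times> D)"
  proof (rule bij_betwI[where g = "\<lambda>(m,n). ((m+n) div 2, (m-n) div 2)"])
    show "(\<lambda>(a,b). (a+b, a-b)) \<in> UNIV \<rightarrow> E \<times> E \<union> D \<times> D"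
      by (auto simp: E_def D_def)
    fix y :: "int \<times> int" assume "y \<in> E \<times> E \<union> D \<times> D"
    then obtain m n where "y = (m, n)" "even (m + n)" by (cases y) (auto simp: E_def D_def)
    moreover from this(2) have "(m+n) div 2 + (m-n) div 2 = m" "(m+n) div 2 - (m-n) div 2 = n"
      by presburger+
    ultimately show "(case case y of (m, n) \<Rightarrow> ((m + n) div 2, (m - n) div 2) of (a, b) \<Rightarrow> (a + b, a - b)) = y"
      by simp
  qed auto
  have F: "F (a+b, a-b) = (s*q^2) ^ nat (a^2) * (s*q^2) ^ nat (b^2)" for a b
  proof -
    have "nat ((a+b)^2) + nat ((a-b)^2) = nat ((a+b)^2 + (a-b)^2)" by (simp add: nat_add_distrib)
    also have "(a+b)^2 + (a-b)^2 = 2 * (a^2+b^2)" by algebra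
    also have "nat \<dots> = 2 * (nat (a^2) + nat (b^2))" by (simp add: nat_mult_distrib nat_add_distrib)
    finally have e: "f (a+b) * f (a-b) = (q^2) ^ (nat (a^2) + nat (b^2))"
      unfolding f_def by (metis power_add power_mult)
    have "s ^ (nat (a^2) + nat (b^2)) = (if even (a+b) then 1 else s)"
      using s by (auto simp: even_nat_iff uminus_power_if)
    then show ?thesis using e by (simp add: F_def power_mult_distrib power_add)
  qed
  have n: "norm (s*q^2) < 1" using q s by (auto simp: norm_mult norm_power power_less_one_iff)
  have "((\<lambda>(a,b). (s*q^2) ^ nat (a^2) * (s*q^2) ^ nat (b^2)) has_sum
      (ramanujan_phi (s*q^2) * ramanujan_phi (s*q^2))) (UNIV \<times> UNIV)"
    using has_sum_phi[OF n] by (intro has_sum_product abs_summable_square_powers n)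
  then have "((\<lambda>x. F (case x of (a,b) \<Rightarrow> (a+b, a-b))) has_sum (ramanujan_phi (s*q^2) ^ 2)) UNIV"
    by (simp add: power2_eq_square case_prod_beta' F)
  then have "(F has_sum (ramanujan_phi (s*q^2) ^ 2)) (E \<times> E \<union> D \<times> D)"
    using has_sum_reindex_bij_betw[OF bij, of F] by simp
  with 3 show ?thesis using has_sum_unique by blast
qed

text \<open>For \<open>s = -1\<close> the formula \<open>phi_square\<close> is a difference of
  squares whose factors are the two dissections. Together with the case \<open>s = 1\<close> below,
  this yields X^2 = 2x/(1 + x^2).\<close>

lemma phi_mult_phi_minus:
  assumes "norm q < 1"
  shows "ramanujan_phi (- (q^2)) ^ 2 = ramanujan_phi q * ramanujan_phi (- q)"
proof -
  have "ramanujan_phi (- (q^2)) ^ 2 = ramanujan_phi (q^4) ^ 2 - (2 * q * ramanujan_psi (q^8)) ^ 2"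
    using phi_square[OF assms, of "-1"] by simp
  then show ?thesis unfolding phi_dissect[OF assms] phi_minus_dissect[OF assms] by algebra
qed

lemma phi_square_plus:
  assumes "norm q < 1"
  shows "2 * ramanujan_phi (q^2) ^ 2 = ramanujan_phi q ^ 2 + ramanujan_phi (- q) ^ 2"
proof -
  have "ramanujan_phi (q^2) ^ 2 = ramanujan_phi (q^4) ^ 2 + (2 * q * ramanujan_psi (q^8)) ^ 2"
    using phi_square[OF assms, of 1] by simp
  then show ?thesis unfolding phi_dissect[OF assms] phi_minus_dissect[OF assms] by algebra
qed

subsection \<open>Holomorphy and absence of zeros\<close>

lemma holomorphic_psi: "ramanujan_psi holomorphic_on ball 0 1"
  using holomorphic_lacunary[OF le_triangular] by (simp add: ramanujan_psi_def [abs_def])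

lemma holomorphic_phi: "ramanujan_phi holomorphic_on ball 0 1"
proof -
  have e: "n \<le> n^2" "n \<le> (Suc n)^2" for n :: nat by (simp_all add: power2_eq_square)
  \<comment> \<open>The integers are split into n and -1-n for n \<ge> 0, so that 0 is counted once
    and both halves are lacunary power series.\<close>
  have phi: "ramanujan_phi q = (\<Sum>n. q ^ (n^2)) + (\<Sum>n. q ^ (Suc n)^2)" if q: "q \<in> ball 0 1" for q
  proof -
    have n: "norm q < 1" using q by simp
    have 1: "nat ((int n)^2) = n^2" "nat ((- 1 - int n)^2) = (Suc n)^2" for n
    proof -
      have "(int n)^2 = int (n^2)" "(- 1 - int n)^2 = int ((Suc n)^2)"
        by (simp_all add: power2_eq_square algebra_simps)
      then show "nat ((int n)^2) = n^2" "nat ((- 1 - int n)^2) = (Suc n)^2" by (simp_all only: nat_int)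
    qed
    have "((\<lambda>m. q ^ nat (m^2)) has_sum (\<Sum>n. q ^ (n^2))) (range int)"
      using has_sum_lacunary[OF n e(1)] by (subst has_sum_reindex) (auto simp: inj_on_def o_def 1)
    moreover have "((\<lambda>m. q ^ nat (m^2)) has_sum (\<Sum>n. q ^ (Suc n)^2)) (range (\<lambda>n. - 1 - int n))"
      using has_sum_lacunary[OF n e(2)] by (subst has_sum_reindex) (auto simp: inj_on_def o_def 1)
    moreover have "range int \<inter> range (\<lambda>n. - 1 - int n) = {}" by auto
    ultimately have "((\<lambda>m. q ^ nat (m^2)) has_sum ((\<Sum>n. q ^ (n^2)) + (\<Sum>n. q ^ (Suc n)^2)))
        (range int \<union> range (\<lambda>n. - 1 - int n))"
      by (rule has_sum_Un_disjoint)
    moreover have "m \<in> range int \<union> range (\<lambda>n. - 1 - int n)" for m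
    proof (cases "m \<ge> 0")
      case True then show ?thesis by (intro UnI1 range_eqI[of _ _ "nat m"]) simp
    next
      case False then show ?thesis by (intro UnI2 range_eqI[of _ _ "nat (- 1 - m)"]) simp
    qed
    then have "range int \<union> range (\<lambda>n. - 1 - int n) = UNIV" by blast
    ultimately show ?thesis using has_sum_unique[OF has_sum_phi[OF n]] by simp
  qed
  have "(\<lambda>q. (\<Sum>n. q ^ (n^2)) + (\<Sum>n. q ^ (Suc n)^2)) holomorphic_on ball (0::complex) 1"
    using e by (intro holomorphic_on_add holomorphic_lacunary)
  then show ?thesis by (rule holomorphic_transform) (simp add: phi)
qed

lemma psi_0: "ramanujan_psi 0 = 1"
proof -
  have "n * (n + 1) div 2 \<noteq> 0" if "n \<noteq> 0" for n :: nat using le_triangular[of n] that by linarith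
  then have "(\<Sum>n. (0::complex) ^ (n * (n + 1) div 2)) = (\<Sum>n\<in>{0}. 0 ^ (n * (n + 1) div 2))"
    by (intro suminf_finite) (auto simp: power_0_left)
  then show ?thesis by (simp add: ramanujan_psi_def)
qed

lemma phi_0: "ramanujan_phi 0 = 1"
proof -
  have "((\<lambda>m::int. 0 ^ nat (m^2)) has_sum ramanujan_phi 0) UNIV" by (rule has_sum_phi) simp
  moreover have "((\<lambda>m::int. 0 ^ nat (m^2)) has_sum (1::complex)) UNIV"
    using has_sum_finite_neutralI[of "{0::int}" UNIV "\<lambda>m. 0 ^ nat (m^2)" "1::complex"]
    by (simp add: power_0_left)
  ultimately show ?thesis by (rule has_sum_unique)
qed

lemma isCont_phi: "norm q < 1 \<Longrightarrow> isCont ramanujan_phi q"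
  using holomorphic_on_imp_continuous_on[OF holomorphic_phi]
  by (simp add: continuous_on_eq_continuous_at)

lemma isCont_psi: "norm q < 1 \<Longrightarrow> isCont ramanujan_psi q"
  using holomorphic_on_imp_continuous_on[OF holomorphic_psi]
  by (simp add: continuous_on_eq_continuous_at)

text \<open>A zero at \<open>q\<close> propagates to all \<open>q ^ 2^n\<close>, which tend to 0,
  and continuity would force \<open>f 0 = 0\<close>.\<close>

lemma nonzero_by_squaring:
  fixes f :: "complex \<Rightarrow> complex"
  assumes "isCont f 0" "f 0 \<noteq> 0" "norm q < 1" "q \<noteq> 0"
    and step: "\<And>z. norm z < 1 \<Longrightarrow> z \<noteq> 0 \<Longrightarrow> f z = 0 \<Longrightarrow> f (z^2) = 0"
  shows "f q \<noteq> 0"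
proof
  assume "f q = 0"
  have zero: "f (q ^ 2^n) = 0" for n
  proof (induction n)
    case (Suc n)
    have "norm (q ^ 2^n) < 1" using assms(3) by (simp add: norm_power power_less_one_iff)
    from step[OF this _ Suc] show ?case using assms(4) by (simp add: power_even_eq)
  qed (simp add: \<open>f q = 0\<close>)
  have "(\<lambda>n. q ^ 2^n) \<longlonglongrightarrow> 0"
    using LIMSEQ_subseq_LIMSEQ[OF LIMSEQ_power_zero[OF assms(3)], of "\<lambda>n. 2^n"]
    by (simp add: o_def strict_mono_def)
  from isCont_tendsto_compose[OF assms(1) this] have "(\<lambda>n. 0) \<longlonglongrightarrow> f 0" by (simp add: zero)
  then show False using assms(2) by (simp add: LIMSEQ_const_iff)
qed

lemma phi_nonzero:
  assumes "norm q < 1"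
  shows "ramanujan_phi q \<noteq> 0"
proof (cases "q = 0")
  case False
  \<comment> \<open>The product formula carries a zero of \<phi>(-z) to one of \<phi>(-z^2), so the
    squaring argument applies to z \<mapsto> \<phi>(-z).\<close>
  have "ramanujan_phi (- (- q)) \<noteq> 0"
  proof (rule nonzero_by_squaring[where f = "\<lambda>z. ramanujan_phi (- z)"])
    show "isCont (\<lambda>z. ramanujan_phi (- z)) 0"
      by (intro isCont_o2[OF _ isCont_phi]) auto
    fix z :: complex assume "norm z < 1" "ramanujan_phi (- z) = 0"
    then show "ramanujan_phi (- (z^2)) = 0" using phi_mult_phi_minus[of z] by simp
  qed (use assms False in \<open>auto simp: phi_0\<close>)
  then show ?thesis by simp
qed (simp add: phi_0)

text \<open>If \<open>\<psi> (z ^ 8) = 0\<close> then \<open>\<phi> z = \<phi> (- z)\<close>, whence \<open>\<phi> (z\<^sup>2)\<close> and \<open>\<phi> (- z\<^sup>2)\<close> have equal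
  squares; they are not opposite since their sum is \<open>2 * \<phi> (z ^ 8)\<close>.\<close>

lemma psi_nonzero:
  assumes "norm q < 1" "q \<noteq> 0"
  shows "ramanujan_psi (q^8) \<noteq> 0"
proof (rule nonzero_by_squaring[where f = "\<lambda>z. ramanujan_psi (z^8)", OF _ _ assms])
  show "isCont (\<lambda>z. ramanujan_psi (z^8)) 0"
    by (intro isCont_o2[OF _ isCont_psi]) auto
  fix z :: complex assume z: "norm z < 1" "z \<noteq> 0" "ramanujan_psi (z^8) = 0"
  have z2: "norm (z^2) < 1" "norm (z^8) < 1" using z by (auto simp: norm_power power_less_one_iff)
  have "ramanujan_phi (z^2) ^ 2 = ramanujan_phi (- (z^2)) ^ 2"
    using phi_square_plus[OF z(1)] phi_mult_phi_minus[OF z(1)] phi_dissect[OF z(1)] phi_minus_dissect[OF z(1)] z(3)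
    by (simp add: power2_eq_square)
  moreover have "ramanujan_phi (z^2) + ramanujan_phi (- (z^2)) = 2 * ramanujan_phi (z^8)"
    using phi_dissect[OF z2(1)] phi_minus_dissect[OF z2(1)] by (simp flip: power_mult)
  then have "ramanujan_phi (z^2) \<noteq> - ramanujan_phi (- (z^2))"
    using phi_nonzero[OF z2(2)] by auto
  ultimately have "ramanujan_phi (z^2) = ramanujan_phi (- (z^2))" by (simp add: power2_eq_iff)
  then show "ramanujan_psi ((z^2)^8) = 0"
    using phi_dissect[OF z2(1)] phi_minus_dissect[OF z2(1)] z(2) by simp
qed (simp add: psi_0)

subsection \<open>The modular equation of degree 5\<close>

text \<open>The polynomial \<open>P(x, y)\<close> homogenised with \<open>x = b / a\<close> and \<open>y = B / A\<close>.\<close>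

definition quintic :: "'a::comm_ring_1 \<Rightarrow> 'a \<Rightarrow> 'a \<Rightarrow> 'a \<Rightarrow> 'a" where
  "quintic a b A B = ((b*A - a*B) * ((b*A)^2 + 6*(b*A)*(a*B) + (a*B)^2))^2
     - 16*(a*b*A*B) * ((a*A)^2 - (b*B)^2)^2"

text \<open>Expanding the square shows \<open>quintic c d C D = M + c*d*C*D*N\<close>, where
  \<open>M\<close> and \<open>N\<close> depend only on squares of the variables. Changing the sign
  of \<open>d\<close> flips the second term, so the product is \<open>M^2 - s*t*N^2\<close>. The
  Landen relations then express it through \<open>a\<close>, \<open>b\<close>, \<open>A\<close>,
  \<open>B\<close>.\<close>

lemma quintic_descent:
  fixes a b c d A B C D :: "'a::field_char_0"
  assumes "2*c^2 = a^2+b^2" "d^2 = a*b" "2*C^2 = A^2+B^2" "D^2 = A*B"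
  shows "64 * (quintic c d C D * quintic c (-d) C D) = quintic a b A B * quintic a b B A"
proof -
  define s t W where "s = d^2*C^2" and "t = c^2*D^2" and "W = c^2*C^2 - d^2*D^2"
  define M N where "M = s*(s-5*t)^2 + t*(5 * s - t)^2" and "N = 2*(s-5*t)*(5 * s - t) - 16*W^2"
  have *: "quintic c d C D * quintic c (-d) C D = M^2 - s*t*N^2"
    unfolding quintic_def M_def N_def s_def t_def W_def by algebra
  define S T V where "S = a*b*(A^2+B^2)" and "T = A*B*(a^2+b^2)" and "V = (a^2+b^2)*(A^2+B^2) - 4*a*b*A*B"
  have c: "c^2 = (a^2+b^2)/2" "C^2 = (A^2+B^2)/2" using assms by (simp_all add: field_simps)
  have 1: "s = S/2" "t = T/2" "W = V/4"
    unfolding s_def t_def W_def S_def T_def V_def assms c by (simp_all add: field_simps)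
  have "64*(M^2 - s*t*N^2) = (S*(S-5*T)^2 + T*(5 * S - T)^2)^2 - S*T*(2*(S-5*T)*(5 * S - T) - 4*V^2)^2"
    unfolding M_def N_def 1 by (simp add: power2_eq_square field_simps)
  also have "\<dots> = quintic a b A B * quintic a b B A"
    unfolding quintic_def S_def T_def V_def by algebra
  finally show ?thesis using * by simp
qed

text \<open>The quotient by \<open>1024*q^6\<close> in the identity below, with \<open>T\<close>
  standing for \<open>q^2\<close>. It is written out so that divisibility becomes a polynomial
  identity. At \<open>T = 0\<close> with the other arguments 1 its value is 8.\<close>

definition quintic_cofactor :: "'a::comm_ring_1 \<Rightarrow> 'a \<Rightarrow> 'a \<Rightarrow> 'a \<Rightarrow> 'a \<Rightarrow> 'a" where
  "quintic_cofactor T c d C D =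
    (let p = d*C; w = c*C; r = c*D; z = 4*d*D;
         p' = p + T^2*r; p'' = p - T^2*r; w' = w + T^3*z; w'' = w - T^3*z
     in (r*(w'^2 + w*w'') + T*p*z*(3*w + T^3*z)) * (p'*w'^2 + w*p''*w'')
        - 4*T*(r*p'*w' + 2*p*(r*w + T*z*p)) * (p'^2*w' + p*p''*w'')
        + 4*p'^6 + T^3*(4*D^2*c^2 - 16*T*d^2*D^2)*p''^2*w''^2)"

text \<open>The arguments are the dissections of \<phi>(q), \<phi>(-q), \<phi>(-q^5), \<phi>(q^5).
  The last two are exchanged, so this exhibits the zero of order 6 of P(x, 1/y).\<close>

lemma quintic_dissect:
  fixes q c d C D :: "'a::idom"
  shows "quintic (c+2*q*d) (c-2*q*d) (C-2*q^5*D) (C+2*q^5*D) = 1024*q^6 * quintic_cofactor (q^2) c d C D"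
  unfolding quintic_def quintic_cofactor_def Let_def by algebra

text \<open>Let \<open>h q\<close> be the left-hand side. Then \<open>64 * h (q\<^sup>2) * k q = h q * g q\<close> by quintic_descent, where
  \<open>k 0 = 64\<close> and \<open>g q = 1024 * q ^ 6 * S q\<close> with \<open>S 0 = 8\<close>. If \<open>h q = f q * q ^ n\<close> with \<open>f 0 \<noteq> 0\<close>,
  comparing orders gives \<open>2 * n = n + 6\<close>, and then comparing leading coefficients gives the
  contradiction \<open>64 * 64 * f 0 = 1024 * 8 * f 0\<close>.\<close>

lemma quintic_phi:
  assumes "norm q < 1"
  shows "quintic (ramanujan_phi q) (ramanujan_phi (- q))
    (ramanujan_phi (q^5)) (ramanujan_phi (- (q^5))) = 0"
proof (rule ccontr)
  define h where "h q = quintic (ramanujan_phi q) (ramanujan_phi (- q))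
    (ramanujan_phi (q^5)) (ramanujan_phi (- (q^5)))" for q
  define k where "k q = quintic (ramanujan_phi (q^2)) (- ramanujan_phi (- (q^2)))
    (ramanujan_phi ((q^5)^2)) (ramanujan_phi (- ((q^5)^2)))" for q
  define S where "S q = quintic_cofactor (q^2) (ramanujan_phi (q^4)) (ramanujan_psi (q^8))
    (ramanujan_phi ((q^5)^4)) (ramanujan_psi ((q^5)^8))" for q
  assume "\<not> ?thesis"
  then have q: "q \<in> ball 0 1" "h q \<noteq> 0" using assms by (auto simp: h_def)
  have phi: "(\<lambda>z. ramanujan_phi (g z)) holomorphic_on ball 0 1"
    if "g holomorphic_on ball 0 1" "\<And>z. norm z < 1 \<Longrightarrow> norm (g z) < 1" for g
    using holomorphic_on_compose_gen[OF that(1) holomorphic_phi] that(2) by (simp add: o_def image_subset_iff)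
  have hol: "h holomorphic_on ball 0 1"
    unfolding h_def [abs_def] quintic_def
    by (intro holomorphic_intros phi) (auto simp: norm_power power_less_one_iff)
  obtain n f r where r: "r > 0" "cball 0 r \<subseteq> ball (0::complex) 1" and f: "f holomorphic_on cball 0 r"
      "\<And>w. w \<in> cball 0 r \<Longrightarrow> h w = f w * w ^ n \<and> f w \<noteq> 0"
  proof -
    have "\<exists>w\<in>ball 0 1. h w \<noteq> 0" using q by blast
    from zorder_exist_zero[OF hol _ _ _ this, of 0] show ?thesis using that by auto
  qed
  have r1: "r < 1" using r(2)[THEN subsetD, of "of_real r"] r(1) by simp
  have f0: "f 0 \<noteq> 0" using f(2)[of 0] r by simp
  have "isCont f 0"
    using f(1) r(1) by (meson ball_subset_cball centre_in_ball continuous_on_eq_continuous_at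
      holomorphic_on_imp_continuous_on holomorphic_on_subset open_ball)
  then have lim_f: "f \<midarrow>0\<rightarrow> f 0" by (simp add: isCont_def)
  have lim_f2: "(\<lambda>w. f (w^2)) \<midarrow>0\<rightarrow> f 0"
    by (rule isCont_tendsto_compose[OF \<open>isCont f 0\<close>]) (auto intro!: tendsto_eq_intros)
  have lim_phi: "(\<lambda>w. ramanujan_phi (g w)) \<midarrow>0\<rightarrow> 1" if "g \<midarrow>0\<rightarrow> 0" for g
    using isCont_tendsto_compose[OF isCont_phi that] by (simp add: phi_0)
  have lim_psi: "(\<lambda>w. ramanujan_psi (g w)) \<midarrow>0\<rightarrow> 1" if "g \<midarrow>0\<rightarrow> 0" for g
    using isCont_tendsto_compose[OF isCont_psi that] by (simp add: psi_0)
  \<comment> \<open>At 0 the arguments are 1, -1, 1, 1, and the value is ((-2)(1 - 6 + 1))^2 = 64,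
    since the subtracted term vanishes.\<close>
  have lim_k: "k \<midarrow>0\<rightarrow> 64"
    unfolding k_def [abs_def] quintic_def
    by (rule tendsto_eq_intros lim_phi refl | simp)+
  have lim_S: "S \<midarrow>0\<rightarrow> 8"
    unfolding S_def [abs_def] quintic_cofactor_def Let_def
    by (rule tendsto_eq_intros lim_phi lim_psi refl | simp)+
  have fun_eq: "f (w^2) * k w * w ^ (2*n) = 16 * f w * S w * w ^ (n + 6)" if w: "norm w < r" for w
  proof -
    have w1: "norm w < 1" "norm (w^5) < 1" using w r1 by (auto simp: norm_power power_less_one_iff)
    have "64 * (h (w^2) * k w) = h w * quintic (ramanujan_phi w) (ramanujan_phi (- w))
        (ramanujan_phi (- (w^5))) (ramanujan_phi (w^5))"
      unfolding h_def k_def power_commutes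
      using quintic_descent[OF phi_square_plus[OF w1(1)] phi_mult_phi_minus[OF w1(1)]
          phi_square_plus[OF w1(2)] phi_mult_phi_minus[OF w1(2)]]
      by (simp flip: power_mult)
    also have "quintic (ramanujan_phi w) (ramanujan_phi (- w))
        (ramanujan_phi (- (w^5))) (ramanujan_phi (w^5)) = 1024 * w^6 * S w"
      unfolding S_def quintic_dissect[symmetric]
      using phi_dissect[OF w1(1)] phi_minus_dissect[OF w1(1)]
        phi_dissect[OF w1(2)] phi_minus_dissect[OF w1(2)] by simp
    finally have *: "h (w^2) * k w = 16 * h w * w^6 * S w" by (simp add: algebra_simps)
    have "norm (w^2) \<le> r"
      using w w1 power_decreasing[of 1 2 "norm w"] by (simp add: norm_power)
    then have "h (w^2) = f (w^2) * w ^ (2*n)" "h w = f w * w ^ n"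
      using f(2)[of "w^2"] f(2)[of w] w by (simp_all add: power_mult)
    then show ?thesis using * by (simp add: power_add algebra_simps)
  qed
  \<comment> \<open>Comparing limits over \<open>w \<noteq> 0\<close> allows powers of
    \<open>w\<close> to be cancelled before passing to 0.\<close>
  have lim_unique: "x = y" if "u \<midarrow>0\<rightarrow> x" "v \<midarrow>0\<rightarrow> y" "\<And>w. norm w < r \<Longrightarrow> w \<noteq> 0 \<Longrightarrow> u w = v w"
    for u v :: "complex \<Rightarrow> complex" and x y
  proof -
    have "eventually (\<lambda>w. u w = v w) (at 0)"
      unfolding eventually_at using that(3) r(1) by (auto simp: dist_norm)
    then have "v \<midarrow>0\<rightarrow> x" using that(1) tendsto_cong by blast
    then show ?thesis using that(2) LIM_unique by blast
  qed
  consider "n < 6" | "n = 6" | "n > 6" by linarith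
  then show False
  proof cases
    case 1
    have "f 0 * 64 = 16 * f 0 * 8 * 0 ^ (6 - n)"
    proof (rule lim_unique)
      show "(\<lambda>w. f (w^2) * k w) \<midarrow>0\<rightarrow> f 0 * 64" by (intro tendsto_intros lim_f2 lim_k)
      show "(\<lambda>w. 16 * f w * S w * w ^ (6 - n)) \<midarrow>0\<rightarrow> 16 * f 0 * 8 * 0 ^ (6 - n)"
        by (intro tendsto_intros lim_f lim_S)
      fix w :: complex assume w: "norm w < r" "w \<noteq> 0"
      have "w ^ (n + 6) = w ^ (6 - n) * w ^ (2*n)" using 1 by (simp flip: power_add)
      with fun_eq[OF w(1)] w show "f (w^2) * k w = 16 * f w * S w * w ^ (6 - n)" by simp
    qed
    with 1 f0 show False by (simp add: power_0_left)
  next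
    case 2
    have "f 0 * 64 = 16 * f 0 * 8"
    proof (rule lim_unique)
      show "(\<lambda>w. f (w^2) * k w) \<midarrow>0\<rightarrow> f 0 * 64" by (intro tendsto_intros lim_f2 lim_k)
      show "(\<lambda>w. 16 * f w * S w) \<midarrow>0\<rightarrow> 16 * f 0 * 8" by (intro tendsto_intros lim_f lim_S)
      fix w :: complex assume w: "norm w < r" "w \<noteq> 0"
      with fun_eq[OF w(1)] 2 show "f (w^2) * k w = 16 * f w * S w" by simp
    qed
    with f0 show False by simp
  next
    case 3
    have "f 0 * 64 * 0 ^ (n - 6) = 16 * f 0 * 8"
    proof (rule lim_unique)
      show "(\<lambda>w. f (w^2) * k w * w ^ (n - 6)) \<midarrow>0\<rightarrow> f 0 * 64 * 0 ^ (n - 6)"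
        by (intro tendsto_intros lim_f2 lim_k)
      show "(\<lambda>w. 16 * f w * S w) \<midarrow>0\<rightarrow> 16 * f 0 * 8" by (intro tendsto_intros lim_f lim_S)
      fix w :: complex assume w: "norm w < r" "w \<noteq> 0"
      have "w ^ (2*n) = w ^ (n - 6) * w ^ (n + 6)" using 3 by (simp flip: power_add)
      with fun_eq[OF w(1)] w show "f (w^2) * k w * w ^ (n - 6) = 16 * f w * S w" by (simp add: mult.assoc)
    qed
    with 3 f0 show False by (simp add: power_0_left)
  qed
qed

section \<open>From the modular equation to the identity for A_5 and B_5\<close>

text \<open>The roots enter only through products of an odd power of \<open>\<alpha>\<close> and an
  odd power of \<open>\<beta>\<close>. These are rational in \<open>u\<close> and \<open>v\<close>,
  because \<open>\<alpha> * \<beta> = u\<close> and \<open>\<alpha> / \<beta> = v\<close>. Clearing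
  denominators leaves a multiple of the quintic.\<close>

lemma quintic_quotients:
  fixes \<alpha> \<beta> u v :: complex
  assumes nz: "u \<noteq> 0" "v \<noteq> 0" and roots: "\<alpha>^2 = u * v" "\<beta>^2 = u/v" "\<alpha>*\<beta> = u"
    and quintic: "quintic (4+u) u (4+v) v = 0"
  shows "(u/v) ^ 3 + 1 / (u/v) ^ 3 - 1620 =
      70 * ((u/v) ^ 2 + 1 / (u/v) ^ 2) + 785 * (u/v + 1 / (u/v))
      + ((u * v) ^ 2 + 8 ^ 4 / (u * v) ^ 2)
      + 80 * (\<alpha> + 8 / \<alpha>) * (5 * (\<beta> + 1 / \<beta>) + (\<beta> ^ 3 + 1 / \<beta> ^ 3))
      + 20 * (u * v + 8 ^ 2 / (u * v)) * (5 + 2 * (u/v + 1 / (u/v)))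
      + 10 * (\<alpha> ^ 3 + 8 ^ 3 / \<alpha> ^ 3) * (\<beta> + 1 / \<beta>)"
proof -
  have \<beta>: "\<beta> \<noteq> 0" "\<alpha> \<noteq> 0" using roots nz by auto
  have "\<alpha> = u / \<beta>" "u = v * \<beta>^2" using roots nz \<beta> by (simp_all add: field_simps)
  then have v: "\<alpha> = v * \<beta>" "u = v * \<beta>^2"
    using \<beta> by (simp_all add: power2_eq_square)
  have 1: "(\<alpha> + 8 / \<alpha>) * (\<beta> + 1 / \<beta>) = u + v + 8/u + 8/v"
    using nz \<beta> by (simp add: v field_simps power2_eq_square)
  have 2: "(\<alpha> + 8 / \<alpha>) * (\<beta> ^ 3 + 1 / \<beta> ^ 3) = u^2/v + v^2/u + 8*u/v^2 + 8 * v/u^2"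
    using nz \<beta> by (simp add: v field_simps power2_eq_square power3_eq_cube)
  have 3: "(\<alpha> ^ 3 + 8 ^ 3 / \<alpha> ^ 3) * (\<beta> + 1 / \<beta>) = u^2 * v + u * v^2 + 512/(u^2 * v) + 512/(u * v^2)"
    using nz \<beta> by (simp add: v field_simps power2_eq_square power3_eq_cube)
  have distrib: "80 * a * (5 * b + c) = 400 * (a * b) + 80 * (a * c)" for a b c :: complex
    by (simp add: algebra_simps)
  \<comment> \<open>\<open>L\<close> is the difference of the two sides of the claim, multiplied by
    \<open>u^3 * v^3\<close>.\<close>
  define L where "L = u^6 + v^6 - 1620*u^3 * v^3 - 70*(u^5 * v + u * v^5) - 785*(u^4 * v^2+u^2 * v^4)
    - u^5 * v^5 - 8^4*u * v - 80*(5*(u^4 * v^3+u^3 * v^4+8*u^2 * v^3+8*u^3 * v^2) + u^5 * v^2+u^2 * v^5+8*u^4 * v+8*u * v^4)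
    - 20*(u^2 * v^2+64)*(5*u^2 * v^2 + 2*u^3 * v+2*u * v^3) - 10*(u^5 * v^4+u^4 * v^5+512*u * v^2+512*u^2 * v)"
  have "quintic (4+u) u (4+v) v = 4096 * L"
    unfolding quintic_def L_def using nz by (simp add: field_simps) algebra
  with quintic have "L = 0" by simp
  have "(u/v) ^ 3 + 1 / (u/v) ^ 3 - 1620 - (70 * ((u/v) ^ 2 + 1 / (u/v) ^ 2) + 785 * (u/v + 1 / (u/v))
      + ((u * v) ^ 2 + 8 ^ 4 / (u * v) ^ 2)
      + (400 * (u + v + 8/u + 8/v) + 80 * (u^2/v + v^2/u + 8*u/v^2 + 8 * v/u^2))
      + 20 * (u * v + 8 ^ 2 / (u * v)) * (5 + 2 * (u/v + 1 / (u/v)))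
      + 10 * (u^2 * v + u * v^2 + 512/(u^2 * v) + 512/(u * v^2))) = L / (u^3 * v^3)"
    unfolding L_def using nz by (simp add: field_simps) algebra
  also have "\<dots> = 0" using \<open>L = 0\<close> by simp
  finally show ?thesis
    unfolding distrib 3 mult.assoc[of 10 "\<alpha> ^ 3 + 8 ^ 3 / \<alpha> ^ 3"] 1 2 by (simp only: right_minus_eq)
qed

text \<open>The quintic is homogeneous of degree 6 in (a, b) and in (A, B) separately, so common
  factors of the theta values can be divided out.\<close>

lemma quintic_scale:
  fixes x y a b A B :: "'a::idom"
  shows "quintic (x * a) (x * b) (y * A) (y * B) = x ^ 6 * y ^ 6 * quintic a b A B"
  unfolding quintic_def by algebra

theorem theorem3p5:
  fixes q sqrtA sqrtB :: complex
  assumes "0 < norm q" and "norm q < 1"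
    and "admissible_roots q sqrtA sqrtB"
  shows "B5 q ^ 3 + 1 / B5 q ^ 3 - 1620 =
      70 * (B5 q ^ 2 + 1 / B5 q ^ 2) + 785 * (B5 q + 1 / B5 q)
      + (A5 q ^ 2 + 8 ^ 4 / A5 q ^ 2)
      + 80 * (sqrtA + 8 / sqrtA) *
          (5 * (sqrtB + 1 / sqrtB) + (sqrtB ^ 3 + 1 / sqrtB ^ 3))
      + 20 * (A5 q + 8 ^ 2 / A5 q) * (5 + 2 * (B5 q + 1 / B5 q))
      + 10 * (sqrtA ^ 3 + 8 ^ 3 / sqrtA ^ 3) * (sqrtB + 1 / sqrtB)"
proof -
  define u v where "u = ramanujan_phi (- q) / (q * ramanujan_psi (q^8))"
    and "v = ramanujan_phi (- (q^5)) / (q^5 * ramanujan_psi ((q^5)^8))"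
  have q: "q \<noteq> 0" "norm (q^5) < 1" using assms by (auto simp: norm_power power_less_one_iff)
  have nz: "ramanujan_psi (q^8) \<noteq> 0" "ramanujan_psi ((q^5)^8) \<noteq> 0"
    "ramanujan_phi (- q) \<noteq> 0" "ramanujan_phi (- (q^5)) \<noteq> 0"
    using assms q psi_nonzero[of q] psi_nonzero[of "q^5"] phi_nonzero[of "- q"] phi_nonzero[of "- (q^5)"] by auto
  have uv: "u \<noteq> 0" "v \<noteq> 0" using nz q by (auto simp: u_def v_def)
  \<comment> \<open>The powers match because q^6 = q q^5, q^(-4) = q / q^5 and q^40 =
    (q^5)^8.\<close>
  have A5: "A5 q = u * v" unfolding A5_def u_def v_def
    using q nz by (simp add: field_simps flip: power_mult power_add power_Suc)
  have B5: "B5 q = u / v" unfolding B5_def u_def v_def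
    using q nz by (simp add: field_simps power_int_minus flip: power_mult power_add power_Suc)
  define x y where "x = q * ramanujan_psi (q^8)" and "y = q^5 * ramanujan_psi ((q^5)^8)"
  have xy: "x \<noteq> 0" "y \<noteq> 0" using q nz by (auto simp: x_def y_def)
  have "ramanujan_phi (- q) = x * u" "ramanujan_phi (- (q^5)) = y * v"
    using xy unfolding u_def v_def x_def[symmetric] y_def[symmetric] by simp_all
  \<comment> \<open>Subtracting the two dissections gives \<phi>(q) = \<phi>(-q) + 4 q \<psi>(q^8),
    which is the source of the shift by 4.\<close>
  moreover from this have "ramanujan_phi q = x * (4+u)" "ramanujan_phi (q^5) = y * (4+v)"
    using phi_dissect[OF assms(2)] phi_minus_dissect[OF assms(2)] phi_dissect[OF q(2)] phi_minus_dissect[OF q(2)]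
    by (simp_all add: x_def y_def algebra_simps)
  ultimately have "x^6*y^6 * quintic (4+u) u (4+v) v = 0"
    using quintic_phi[OF assms(2)] by (simp only: quintic_scale)
  then have "quintic (4+u) u (4+v) v = 0" using xy by simp
  moreover have "sqrtA^2 = u * v" "sqrtB^2 = u/v" "sqrtA * sqrtB = u"
    using assms(3) unfolding admissible_roots_def A5 B5 by (simp_all add: u_def)
  ultimately show ?thesis unfolding A5 B5 using uv by (intro quintic_quotients)
qed

end
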